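(* With $A$ and $C$ as in the context, $$\lim_{n\to\infty}\frac{C_n}{A_n}=\frac{\zeta(3)}{7}.$$
   Context: The sequences of rational numbers $A=(A_n)_{n\ge0}$ and $C=(C_n)_{n\ge0}$ are the solutions of $$4n^2(16n^2-1)u_{n-1}-(65n^4+130n^3+105n^2+40n+6)u_n+(n+1)^4u_{n+1}=0\qquad(n\ge1)$$ with initial values $(A_0,A_1)=(1,6)$ and $(C_0,C_1)=(0,1)$. $\zeta$ is the Riemann zeta function. *)

theory Defs
  imports "HOL-Analysis.Analysis"
begin

definition solves_recurrence :: "(nat \<Rightarrow> rat) \<Rightarrow> bool" where
  "solves_recurrence u \<longleftrightarrow>
     (\<forall>n\<ge>1. 4 * of_nat n ^ 2 * (16 * of_nat n ^ 2 - 1) * u (n - 1)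
        - (65 * of_nat n ^ 4 + 130 * of_nat n ^ 3 + 105 * of_nat n ^ 2 + 40 * of_nat n + 6) * u n
        + (of_nat n + 1) ^ 4 * u (n + 1) = 0)"

(* The Riemann zeta function on the half-plane Re s > 1, where it is defined by its
   Dirichlet series; its values elsewhere are not meaningful here. *)
definition zeta :: "complex \<Rightarrow> complex" where
  "zeta s = (\<Sum>n. 1 / of_nat (Suc n) powr s)"

end

theory Submission
  imports Defs
begin

text \<open>
  The solution \<open>A\<close> is \<open>A\<^sub>n = (\<Sum>k. (n choose k)\<^sup>2 den(n,k))\<close>, where
  \<open>den(n,k) = (\<Sum>j. (n choose j) (n+j choose j) (k choose j) (k+j choose j))\<close> is a balanced
  \<open>\<^sub>4F\<^sub>3(1)\<close> that reduces to the Apery numbers for \<open>n = k\<close>. Like those, it obeys three-term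
  contiguity relations in \<open>n\<close> and \<open>k\<close>, and only these relations, not the closed form, matter
  below. They have a second solution \<open>num(n,k)\<close> with \<open>num(0,k) = (\<Sum>i=1..k. 1/i\<^sup>3)\<close>. One
  creative-telescoping certificate, using only the contiguity relations, shows that the sums
  of \<open>(n choose k)\<^sup>2 den(n,k)\<close> and of \<open>(n choose k)\<^sup>2 num(n,k)\<close> both solve the recurrence; the latter
  is \<open>7 C\<^sub>n\<close>. The Casoratians of \<open>den\<close> and \<open>num\<close> along rows and columns give
  \<open>num(n,k)/den(n,k) \<rightarrow> \<zeta>(3)\<close> for \<open>k \<rightarrow> \<infinity>\<close> and \<open>0 \<le> \<zeta>(3) den(n,k) - num(n,k) \<le> \<zeta>(3)\<close>. Hence
  \<open>0 \<le> \<zeta>(3) A\<^sub>n - 7 C\<^sub>n \<le> \<zeta>(3) 4\<^sup>n\<close>, whereas the recurrence forces \<open>A\<^sub>n \<ge> 6\<^sup>n\<close>.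
\<close>

section \<open>Arrays governed by two contiguity relations\<close>

definition step_coeff :: "real \<Rightarrow> real \<Rightarrow> real" where
  "step_coeff n k = (n - k) * (n^2 + n + k^2 + k + 1 - n * k)"

definition mid_coeff :: "real \<Rightarrow> real \<Rightarrow> real" where
  "mid_coeff n k = (2 * k + 1) * (k^2 + k + 1 + 2 * n * (n + 1))"

text \<open>
  An array is generated from its row \<open>n = 0\<close> by the relation between \<open>(n+1,k)\<close>, \<open>(n,k+1)\<close> and
  \<open>(n,k)\<close>; the three-term recurrence inside each row is then inherited from row \<open>0\<close>.
\<close>
primrec array :: "(nat \<Rightarrow> real) \<Rightarrow> nat \<Rightarrow> nat \<Rightarrow> real" where
  "array r 0 k = r k"
| "array r (Suc n) k =
     ((real k + 1)^3 * array r n (Suc k) + step_coeff n k * array r n k) / (real n + 1)^3"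

text \<open>
  The second solution violates the homogeneous recurrence at \<open>k = 0\<close>. The value \<open>- d\<close> put in place
  of \<open>0\<^sup>3 x(-1)\<close> absorbs this defect, so that the identities below need no boundary cases.
\<close>
definition shifted :: "real \<Rightarrow> (nat \<Rightarrow> real) \<Rightarrow> nat \<Rightarrow> real" where
  "shifted d x k = (case k of 0 \<Rightarrow> - d | Suc j \<Rightarrow> real k ^ 3 * x j)"

lemma shifted_0 [simp]: "shifted d x 0 = - d"
  and shifted_Suc [simp]: "shifted d x (Suc k) = (real k + 1)^3 * x k"
  by (simp_all add: shifted_def algebra_simps)

definition row_recurrence :: "real \<Rightarrow> nat \<Rightarrow> (nat \<Rightarrow> real) \<Rightarrow> bool" where
  "row_recurrence d n x \<longleftrightarrow>
     (\<forall>k. (real k + 1)^3 * x (Suc k) = mid_coeff n k * x k - shifted d x k)"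

lemma array_Suc:
  "(real n + 1)^3 * array r (Suc n) k
     = (real k + 1)^3 * array r n (Suc k) + step_coeff n k * array r n k"
proof -
  have "(real n + 1)^3 \<noteq> 0" by simp
  then show ?thesis by (simp del: power_eq_0_iff)
qed

lemma shifted_array_Suc:
  "(real n + 1)^3 * shifted d (array r (Suc n)) k
     = real k ^ 6 * array r n k + step_coeff n (real k - 1) * shifted d (array r n) k"
proof (cases k)
  case 0
  \<comment> \<open>This value carries the entry \<open>- d\<close> unchanged from row
    \<open>n\<close> to row \<open>n + 1\<close>.\<close>
  have "step_coeff n (-1) = (real n + 1)^3" unfolding step_coeff_def by algebra
  with 0 show ?thesis by simp
next
  case (Suc j)
  have "(real n + 1)^3 * shifted d (array r (Suc n)) k
      = (real j + 1)^3 * ((real n + 1)^3 * array r (Suc n) j)"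
    using Suc by (simp del: array.simps)
  also have "\<dots> = (real j + 1)^3 * ((real j + 1)^3 * array r n (Suc j) + step_coeff n j * array r n j)"
    by (simp only: array_Suc)
  also have "\<dots> = real k ^ 6 * array r n k + step_coeff n (real k - 1) * shifted d (array r n) k"
    using Suc by (simp add: algebra_simps flip: power_add)
  finally show ?thesis .
qed

text \<open>Compatibility of the two relations: once \<open>y\<close> and \<open>z\<close> are
  eliminated, both sides are linear in \<open>x\<close> and \<open>t\<close> with equal polynomial
  coefficients.\<close>

lemma row_recurrence_step_identity:
  fixes n k x y z t :: real
  assumes "(k + 1)^3 * y = mid_coeff n k * x - t"
    and "(k + 2)^3 * z = mid_coeff n (k + 1) * y - (k + 1)^3 * x"
  shows "(k + 1)^3 * ((k + 2)^3 * z + step_coeff n (k + 1) * y)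
    = mid_coeff (n + 1) k * ((k + 1)^3 * y + step_coeff n k * x)
        - (k^6 * x + step_coeff n (k - 1) * t)"
proof -
  have "(k + 1)^3 * ((k + 2)^3 * z + step_coeff n (k + 1) * y)
      = (mid_coeff n (k + 1) + step_coeff n (k + 1)) * (mid_coeff n k * x - t) - (k + 1)^6 * x"
    unfolding assms(2) assms(1)[symmetric] by algebra
  also have "\<dots> = mid_coeff (n + 1) k * ((mid_coeff n k * x - t) + step_coeff n k * x)
        - (k^6 * x + step_coeff n (k - 1) * t)"
    unfolding mid_coeff_def step_coeff_def by algebra
  finally show ?thesis unfolding assms(1) .
qed

lemma row_recurrence_array:
  assumes "row_recurrence d 0 r"
  shows "row_recurrence d n (array r n)"
proof (induction n)
  case 0
  have "array r 0 = r" by (rule ext) simp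
  with assms show ?case by simp
next
  case (Suc n)
  show ?case unfolding row_recurrence_def
  proof
    fix k
    let ?a = "array r n" and ?b = "array r (Suc n)"
    have e1: "(real k + 1)^3 * ?a (Suc k) = mid_coeff n k * ?a k - shifted d ?a k"
      using Suc unfolding row_recurrence_def by blast
    have e2: "(real k + 2)^3 * ?a (Suc (Suc k))
        = mid_coeff n (real k + 1) * ?a (Suc k) - (real k + 1)^3 * ?a k"
      using Suc[unfolded row_recurrence_def, rule_format, of "Suc k"] by (simp add: algebra_simps)
    have "(real n + 1)^3 * ((real k + 1)^3 * ?b (Suc k))
        = (real k + 1)^3 * ((real n + 1)^3 * ?b (Suc k))" by (simp only: mult.left_commute)
    also have "\<dots> = (real k + 1)^3
        * ((real k + 2)^3 * ?a (Suc (Suc k)) + step_coeff n (real k + 1) * ?a (Suc k))"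
      unfolding array_Suc by (simp add: add.commute)
    also have "\<dots> = mid_coeff (real n + 1) k * ((real n + 1)^3 * ?b k)
        - (real n + 1)^3 * shifted d ?b k"
      unfolding array_Suc shifted_array_Suc by (rule row_recurrence_step_identity[OF e1 e2])
    also have "\<dots> = (real n + 1)^3 * (mid_coeff (Suc n) k * ?b k - shifted d ?b k)"
      by (simp add: algebra_simps del: array.simps)
    finally show "(real k + 1)^3 * ?b (Suc k) = mid_coeff (Suc n) k * ?b k - shifted d ?b k"
      by (simp del: array.simps)
  qed
qed

text \<open>Inverts the step in \<open>n\<close>. By the row recurrence that step is linear in
  \<open>array r n k\<close> and \<open>shifted d (array r n) k\<close>; with a = n + 1 the
  inversion rests on (a^3 - k^3) (a^3 + k^3) + k^6 = a^6.\<close>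

lemma array_down:
  assumes "row_recurrence d 0 r"
  shows "(real n + 1)^3 * array r n k = shifted d (array r (Suc n)) k
    + (real n + 1 - k) * ((real n + 1)^2 + real k ^ 2 - (real n + 1) * k) * array r (Suc n) k"
proof -
  have e: "(real k + 1)^3 * array r n (Suc k) = mid_coeff n k * array r n k - shifted d (array r n) k"
    using row_recurrence_array[OF assms, of n] unfolding row_recurrence_def by blast
  let ?h = "(real n + 1 - k) * ((real n + 1)^2 + real k ^ 2 - (real n + 1) * k)"
  have "(real n + 1)^3 * (shifted d (array r (Suc n)) k + ?h * array r (Suc n) k)
      = (real n + 1)^3 * shifted d (array r (Suc n)) k + ?h * ((real n + 1)^3 * array r (Suc n) k)"
    by (simp only: algebra_simps)
  also have "\<dots> = (real n + 1)^3 * ((real n + 1)^3 * array r n k)"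
    unfolding array_Suc shifted_array_Suc e mid_coeff_def step_coeff_def by algebra
  finally have "(real n + 1)^3 * ((real n + 1)^3 * array r n k)
      = (real n + 1)^3 * (shifted d (array r (Suc n)) k + ?h * array r (Suc n) k)" ..
  moreover have "(real n + 1)^3 \<noteq> 0" by simp
  ultimately show ?thesis by (rule mult_left_cancel[THEN iffD1, rotated])
qed

section \<open>Creative telescoping for the binomial sums\<close>

definition binomial_sum :: "(nat \<Rightarrow> nat \<Rightarrow> real) \<Rightarrow> nat \<Rightarrow> real" where
  "binomial_sum u n = (\<Sum>k\<le>n. real (n choose k)^2 * u n k)"

definition recurrence_real :: "(nat \<Rightarrow> real) \<Rightarrow> bool" where
  "recurrence_real u \<longleftrightarrow>
     (\<forall>n\<ge>1. 4 * real n ^ 2 * (16 * real n ^ 2 - 1) * u (n - 1)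
        - (65 * real n ^ 4 + 130 * real n ^ 3 + 105 * real n ^ 2 + 40 * real n + 6) * u n
        + (real n + 1) ^ 4 * u (n + 1) = 0)"

text \<open>
  The certificate is \<open>(n+1 choose k)\<^sup>2 (k\<^sup>5 p(n,k) x\<^sub>k + s(n,k) k\<^sup>3 x\<^sub>k\<^sub>-\<^sub>1)\<close> up to a factor depending on
  \<open>n\<close> only. Comparing the coefficients of \<open>x\<^sub>k\<^sub>-\<^sub>1\<close> expresses \<open>s\<close> through \<open>p\<close>, and the cubic \<open>p\<close> was
  obtained by solving the remaining linear system for its coefficients.
\<close>
definition cert_p :: "real \<Rightarrow> real \<Rightarrow> real" where
  "cert_p n k = - (9*n + 54*n^2 + 108*n^3 + 63*n^4) + (4 + 42*n + 126*n^2 + 109*n^3) * k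
     - (8 + 49*n + 68*n^2) * k^2 + (4 + 16*n) * k^3"

definition cert_s :: "real \<Rightarrow> real \<Rightarrow> real" where
  "cert_s n k = n^3 * (n + 1)^3
     - (n + 1 - k)^2 * (cert_p n (k + 1) + 4 * (16 * n^2 - 1) * (n - k)^2)"

text \<open>Telescoping of one summand, times n^3 (n+1)^2 and divided by
  \<open>(n+1 choose k)^2\<close>, with rows n - 1 and n + 1 rewritten through row n. Here
  \<open>x\<close> is x_k, \<open>t\<close> is \<open>shifted d x k\<close> and \<open>y\<close> is
  (k+1)^3 x_{k+1}.\<close>

lemma certificate_identity:
  fixes n k x t :: real
  defines "y \<equiv> mid_coeff n k * x - t"
  shows "4 * (16 * n^2 - 1) * (n - k)^2 * (n + 1 - k)^2 * (t + (n - k) * (n^2 + k^2 - n * k) * x)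
      - n^3 * (65 * n^4 + 130 * n^3 + 105 * n^2 + 40 * n + 6) * (n + 1 - k)^2 * x
      + n^3 * (n + 1)^3 * (y + step_coeff n k * x)
    = (n + 1 - k)^2 * (cert_p n (k + 1) * y + (k + 1) * cert_s n (k + 1) * x)
      - (k^5 * cert_p n k * x + cert_s n k * t)"
  unfolding y_def mid_coeff_def step_coeff_def cert_s_def cert_p_def by algebra


lemma binomial_Suc_real:
  "(real n + 1) * real (n choose k) = (real n + 1 - real k) * real (Suc n choose k)"
proof (cases "k \<le> Suc n")
  case True
  have "real (Suc n - k) * real (Suc n choose k) = real (Suc n) * real (n choose k)"
    using binomial_absorb_comp[of "Suc n" k] by (simp only: diff_Suc_1 flip: of_nat_mult)
  with True show ?thesis by (simp add: of_nat_diff algebra_simps)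
next
  case False
  then show ?thesis by (simp add: binomial_eq_0)
qed

lemma binomial_Suc_Suc_real:
  "(real k + 1) * real (Suc n choose Suc k) = (real n + 1) * real (n choose k)"
proof -
  have "real (Suc k * (Suc n choose Suc k)) = real (Suc n * (n choose k))"
    by (simp only: Suc_times_binomial)
  then show ?thesis by (simp only: of_nat_mult of_nat_Suc add.commute)
qed

lemma binomial_sum_extend:
  assumes "n < m"
  shows "binomial_sum u n = (\<Sum>k<m. real (n choose k)^2 * u n k)"
  unfolding binomial_sum_def using assms
  by (intro sum.mono_neutral_left) (auto simp: binomial_eq_0)

lemma recurrence_real_binomial_sum:
  assumes "row_recurrence d 0 r"
  shows "recurrence_real (binomial_sum (array r))"
  unfolding recurrence_real_def
proof (intro allI impI)
  fix n :: nat assume "1 \<le> n"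
  then obtain m where m: "n = Suc m" by (cases n) auto
  define N where "N = real n"
  have N: "N > 0" "real m + 1 = N" using m by (simp_all add: N_def)
  let ?u = "array r"
  let ?\<alpha> = "4 * N^2 * (16 * N^2 - 1)"
  let ?\<beta> = "65 * N^4 + 130 * N^3 + 105 * N^2 + 40 * N + 6"
  define F where "F k = real (Suc n choose k)^2
    * (real k ^ 5 * cert_p N k * ?u n k + cert_s N k * shifted d (?u n) k)" for k
  define G where "G k = ?\<alpha> * (real (m choose k)^2 * ?u m k) - ?\<beta> * (real (n choose k)^2 * ?u n k)
    + (N + 1)^4 * (real (Suc n choose k)^2 * ?u (Suc n) k)" for k
  \<comment> \<open>The factor clears the denominators that arise when all terms are written through
    row \<open>n\<close> and \<open>Suc n choose k\<close>.\<close>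
  have G: "N^3 * (N + 1)^2 * G k = F (Suc k) - F k" for k
  proof -
    define K where "K = real k"
    define D where "D = real (Suc n choose k)"
    define x where "x = ?u n k"
    define t where "t = shifted d (?u n) k"
    define y where "y = mid_coeff N K * x - t"
    define c0 where "c0 = real (m choose k)"
    define c1 where "c1 = real (n choose k)"
    define c2 where "c2 = real (Suc n choose Suc k)"
    define v where "v = ?u m k"
    define w where "w = ?u (Suc n) k"
    have y: "(K + 1)^3 * ?u n (Suc k) = y"
      using row_recurrence_array[OF assms, of n]
      unfolding row_recurrence_def y_def x_def t_def K_def N_def by blast
    have v: "N^3 * v = t + (N - K) * (N^2 + K^2 - N * K) * x"
      using array_down[OF assms, of m k] N(2)
      unfolding v_def t_def x_def K_def m by (simp del: array.simps)
    have w: "(N + 1)^3 * w = y + step_coeff N K * x"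
      using array_Suc[of n r k] y unfolding w_def x_def K_def N_def by simp
    have c1: "(N + 1) * c1 = (N + 1 - K) * D"
      using binomial_Suc_real[of n k] unfolding N_def K_def c1_def D_def .
    have c0: "N * c0 = (N - K) * c1"
      using binomial_Suc_real[of m k] N(2) unfolding K_def c1_def c0_def m by simp
    have c2: "(K + 1) * c2 = (N + 1 - K) * D"
      using binomial_Suc_Suc_real[of k n] c1 unfolding N_def K_def c1_def c2_def by simp
    have c01: "N * (N + 1) * c0 = (N - K) * (N + 1 - K) * D"
      using c0 c1 by algebra
    have "N^3 * (N + 1)^2 * G k
       = 4 * (16 * N^2 - 1) * (N * (N + 1) * c0)^2 * (N^3 * v)
         - N^3 * ?\<beta> * ((N + 1) * c1)^2 * x + N^3 * (N + 1)^3 * D^2 * ((N + 1)^3 * w)"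
      unfolding G_def c0_def[symmetric] c1_def[symmetric] D_def[symmetric]
        x_def[symmetric] v_def[symmetric] w_def[symmetric] by algebra
    also have "\<dots> = D^2 *
        (4 * (16 * N^2 - 1) * (N - K)^2 * (N + 1 - K)^2 * (t + (N - K) * (N^2 + K^2 - N * K) * x)
          - N^3 * ?\<beta> * (N + 1 - K)^2 * x + N^3 * (N + 1)^3 * (y + step_coeff N K * x))"
      unfolding c01 c1 v w by algebra
    also have "\<dots> = D^2 *
        ((N + 1 - K)^2 * (cert_p N (K + 1) * y + (K + 1) * cert_s N (K + 1) * x)
          - (K^5 * cert_p N K * x + cert_s N K * t))"
      unfolding y_def certificate_identity ..
    also have "\<dots> = ((N + 1 - K) * D)^2 * (cert_p N (K + 1) * y + (K + 1) * cert_s N (K + 1) * x)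
          - D^2 * (K^5 * cert_p N K * x + cert_s N K * t)"
      by algebra
    \<comment> \<open>Of \<open>(K + 1)^5\<close>, two powers shift the binomial and three turn
      \<open>?u n (Suc k)\<close> into \<open>y\<close>.\<close>
    also have "((N + 1 - K) * D)^2 * (cert_p N (K + 1) * y + (K + 1) * cert_s N (K + 1) * x)
        = c2^2 * ((K + 1)^5 * cert_p N (K + 1) * ?u n (Suc k)
            + cert_s N (K + 1) * ((K + 1)^3 * x))"
      unfolding y[symmetric] c2[symmetric] by algebra
    also have "\<dots> = F (Suc k)"
      unfolding F_def c2_def K_def x_def by (simp add: add.commute)
    finally show ?thesis unfolding F_def D_def K_def x_def t_def .
  qed
  \<comment> \<open>This removes the boundary value \<open>- d\<close>, so the sums obey the
    homogeneous recurrence even when the rows have a defect.\<close>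
  have "cert_s N 0 = 0"
    by (simp add: cert_s_def cert_p_def eval_nat_numeral algebra_simps)
  then have "F 0 = 0" by (simp add: F_def)
  moreover have "F (n + 2) = 0" by (simp add: F_def binomial_eq_0)
  ultimately have "N^3 * (N + 1)^2 * (\<Sum>k<n+2. G k) = 0"
    unfolding sum_distrib_left G sum_lessThan_telescope by simp
  moreover have "N^3 * (N + 1)^2 \<noteq> 0" using N by simp
  ultimately have "(\<Sum>k<n+2. G k) = 0" by (metis mult_eq_0_iff)
  then have "?\<alpha> * binomial_sum ?u m - ?\<beta> * binomial_sum ?u n
      + (N + 1)^4 * binomial_sum ?u (Suc n) = 0"
    using m unfolding G_def sum.distrib sum_subtractf
    by (simp add: binomial_sum_extend[of _ "n + 2"] sum_distrib_left del: array.simps binomial_Suc_Suc sum.lessThan_Suc)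
  then show "4 * real n ^ 2 * (16 * real n ^ 2 - 1) * binomial_sum ?u (n - 1)
        - (65 * real n ^ 4 + 130 * real n ^ 3 + 105 * real n ^ 2 + 40 * real n + 6) * binomial_sum ?u n
        + (real n + 1) ^ 4 * binomial_sum ?u (n + 1) = 0"
    using m unfolding N_def by simp
qed

section \<open>Uniqueness and growth of solutions\<close>

lemma recurrence_real_unique:
  assumes "recurrence_real u" "recurrence_real v" "u 0 = v 0" "u 1 = v 1"
  shows "u n = v n"
proof (induction n rule: less_induct)
  case (less n)
  show ?case
  proof (cases "n < 2")
    case True
    with assms(3,4) show ?thesis by (cases n) (auto simp: less_Suc_eq numeral_2_eq_2)
  next
    case False
    then obtain m where m: "n = m + 1" "m \<ge> 1" by (cases n) auto
    have "u (m - 1) = v (m - 1)" "u m = v m" using less m by auto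
    then have "(real m + 1)^4 * u n = (real m + 1)^4 * v n"
      using assms(1,2) m unfolding recurrence_real_def by (smt (verit))
    then show ?thesis by (simp del: of_nat_Suc)
  qed
qed

text \<open>The initial ratio 6 persists: with N = m + 1 and u_m at most u_{m+1} / 6, the recurrence
  bounds (N+1)^4 u_{m+2} below by a multiple of u_{m+1} whose factor is at least 6 (N+1)^4.\<close>

lemma recurrence_real_growth:
  assumes "recurrence_real u" "u 0 = 1" "u 1 = 6"
  shows "6 * u n \<le> u (Suc n)"
proof -
  have "u n > 0 \<and> 6 * u n \<le> u (Suc n)"
  proof (induction n)
    case 0
    with assms show ?case by simp
  next
    case (Suc m)
    define N where "N = real (Suc m)"
    have N: "N \<ge> 1" by (simp add: N_def)
    have pos: "u (Suc m) > 0" using Suc by linarith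
    have rec: "4 * N^2 * (16 * N^2 - 1) * u m
        - (65 * N^4 + 130 * N^3 + 105 * N^2 + 40 * N + 6) * u (Suc m)
        + (N + 1)^4 * u (Suc (Suc m)) = 0"
      using assms(1)[unfolded recurrence_real_def, rule_format, of "Suc m"] unfolding N_def by simp
    have "0 \<le> 16 * N^2 - 1" using one_le_power[OF N, of 2] by linarith
    then have "4 * N^2 * (16 * N^2 - 1) * (6 * u m) \<le> 4 * N^2 * (16 * N^2 - 1) * u (Suc m)"
      using Suc by (intro mult_left_mono) auto
    with rec have "6 * ((N + 1)^4 * u (Suc (Suc m)))
       \<ge> (6 * (65 * N^4 + 130 * N^3 + 105 * N^2 + 40 * N + 6) - 4 * N^2 * (16 * N^2 - 1)) * u (Suc m)"
      by (simp add: algebra_simps)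
    moreover have "6 * (65 * N^4 + 130 * N^3 + 105 * N^2 + 40 * N + 6) - 4 * N^2 * (16 * N^2 - 1)
        = 36 * (N + 1)^4 + (290 * N^4 + 636 * N^3 + 418 * N^2 + 96 * N)"
      by algebra
    ultimately have "6 * ((N + 1)^4 * u (Suc (Suc m))) \<ge> 36 * (N + 1)^4 * u (Suc m)"
      using N pos
      by (smt (verit) distrib_right mult_nonneg_nonneg zero_le_power)
    then have "(N + 1)^4 * (6 * u (Suc m)) \<le> (N + 1)^4 * u (Suc (Suc m))" by (simp add: mult_ac)
    then have "6 * u (Suc m) \<le> u (Suc (Suc m))" using N by (simp only: mult_le_cancel_left) (smt (verit) zero_less_power)
    with pos show ?case by simp
  qed
  then show ?thesis by blast
qed

lemma recurrence_real_lower: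
  assumes "recurrence_real u" "u 0 = 1" "u 1 = 6"
  shows "6 ^ n \<le> u n"
proof (induction n)
  case 0
  with assms show ?case by simp
next
  case (Suc n)
  then show ?case using recurrence_real_growth[OF assms, of n] by simp
qed


section \<open>The solutions \<open>num\<close> and \<open>den\<close> and their Casoratians\<close>

definition cubes :: "nat \<Rightarrow> real" where
  "cubes k = (\<Sum>i<k. 1 / (real i + 1)^3)"

abbreviation num :: "nat \<Rightarrow> nat \<Rightarrow> real" where "num \<equiv> array cubes"
abbreviation den :: "nat \<Rightarrow> nat \<Rightarrow> real" where "den \<equiv> array (\<lambda>_. 1)"

lemma cubes_Suc: "(real k + 1)^3 * cubes (Suc k) = (real k + 1)^3 * cubes k + 1"
proof -
  have "(real k + 1)^3 \<noteq> 0" by simp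
  then show ?thesis by (simp add: cubes_def distrib_left del: power_eq_0_iff)
qed

text \<open>In row 0 the recurrence makes k^3 (x_k - x_{k-1}) constant in k. For
  \<open>cubes\<close> the constant is 1, and d = 1 extends this to k = 0.\<close>

lemma row_recurrence_num: "row_recurrence 1 0 cubes"
  unfolding row_recurrence_def
proof
  fix k
  have "shifted 1 cubes k = real k ^ 3 * cubes k - 1"
    using cubes_Suc by (cases k) (simp_all add: cubes_def add.commute)
  moreover have "mid_coeff (real 0) k = (real k + 1)^3 + real k ^ 3"
    unfolding mid_coeff_def by (simp add: eval_nat_numeral algebra_simps)
  ultimately show "(real k + 1)^3 * cubes (Suc k) = mid_coeff (real 0) k * cubes k - shifted 1 cubes k"
    unfolding cubes_Suc by (simp add: algebra_simps)
qed

lemma row_recurrence_den: "row_recurrence 0 0 (\<lambda>_. 1)"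
  unfolding row_recurrence_def
proof
  fix k
  have "shifted 0 (\<lambda>_. 1) k = real k ^ 3"
    by (cases k) (simp_all add: add.commute)
  moreover have "mid_coeff (real 0) k = (real k + 1)^3 + real k ^ 3"
    unfolding mid_coeff_def by (simp add: eval_nat_numeral algebra_simps)
  ultimately show "(real k + 1)^3 * 1 = mid_coeff (real 0) k * 1 - shifted 0 (\<lambda>_. 1) k" by simp
qed

lemmas num_row = row_recurrence_array[OF row_recurrence_num, unfolded row_recurrence_def, rule_format]
lemmas den_row = row_recurrence_array[OF row_recurrence_den, unfolded row_recurrence_def, rule_format]

lemma den_0 [simp]: "den n 0 = 1"
proof (induction n)
  case (Suc n)
  have "(real n + 1)^3 * den (Suc n) 0 = den n (Suc 0) + step_coeff n 0 * den n 0"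
    using array_Suc[of n "\<lambda>_. 1" 0] by simp
  also have "den n (Suc 0) = mid_coeff n 0"
    using den_row[of 0 n] Suc by simp
  also have "mid_coeff n 0 + step_coeff n 0 * den n 0 = (real n + 1)^3 * 1"
    unfolding Suc mid_coeff_def step_coeff_def by (simp add: eval_nat_numeral algebra_simps)
  finally show ?case by (rule mult_left_cancel[THEN iffD1, rotated]) simp
qed simp

text \<open>In this form the row recurrence expresses (k+1)^3 (x_{k+1} - x_k) as k^3 x_k -
  \<open>shifted d x k\<close> plus a term that is nonnegative if x_k is.\<close>

lemma mid_coeff_eq:
  "mid_coeff n k = k^3 + (k + 1)^3 + 2 * (2 * k + 1) * (n * (n + 1))"
  unfolding mid_coeff_def by algebra

text \<open>The second conjunct encodes k^3 (x_k - x_{k-1}) >= 0 with no special case at k =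
  0.\<close>

lemma den_mono_aux: "1 \<le> den n k \<and> shifted 0 (den n) k \<le> real k ^ 3 * den n k"
proof (induction k)
  case 0
  show ?case by simp
next
  case (Suc k)
  have "0 \<le> 2 * (2 * real k + 1) * (real n * (real n + 1)) * den n k"
    using Suc by (intro mult_nonneg_nonneg) auto
  then have "(real k + 1)^3 * den n k \<le> (real k + 1)^3 * den n (Suc k)"
    using Suc unfolding den_row mid_coeff_eq distrib_right[of _ _ "den n k"] by linarith
  moreover from this have "den n k \<le> den n (Suc k)" by (simp add: mult_le_cancel_left_pos)
  ultimately show ?case using Suc by (simp add: add.commute)
qed

lemma den_ge_1: "1 \<le> den n k"
  using den_mono_aux by blast

lemma den_pos: "0 < den n k"
  using den_ge_1[of n k] by linarith

lemma den_mono: "den n k \<le> den n (Suc k)"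
  using den_mono_aux[of n "Suc k"] by (simp add: add.commute)

text \<open>Increments stay at least 1: for n >= 1 the extra term in \<open>mid_coeff_eq\<close>
  outweighs (k+1)^3 - k^3.\<close>

lemma den_ge_linear: "n \<ge> 1 \<Longrightarrow> real k + 1 \<le> den n k"
proof -
  assume n: "n \<ge> 1"
  have "real k + 1 \<le> den n k \<and> real k ^ 3 \<le> real k ^ 3 * den n k - shifted 0 (den n) k"
  proof (induction k)
    case 0
    show ?case by simp
  next
    case (Suc k)
    have "2 \<le> real n * (real n + 1)" using n mult_mono[of 1 "real n" 2 "real n + 1"] by simp
    then have "2 * (2 * real k + 1) * 2 * (real k + 1)
        \<le> 2 * (2 * real k + 1) * (real n * (real n + 1)) * den n k"
      using Suc by (intro mult_mono) auto
    moreover have "(real k + 1)^3 \<le> real k ^ 3 + 2 * (2 * real k + 1) * 2 * (real k + 1)"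
      by (simp add: eval_nat_numeral algebra_simps)
    ultimately have *: "(real k + 1)^3 + (real k + 1)^3 * den n k \<le> (real k + 1)^3 * den n (Suc k)"
      using Suc unfolding den_row mid_coeff_eq by (simp add: distrib_right)
    then have "(real k + 1)^3 * (1 + den n k) \<le> (real k + 1)^3 * den n (Suc k)"
      by (simp add: distrib_left)
    then have "1 + den n k \<le> den n (Suc k)" by (simp add: mult_le_cancel_left_pos)
    with Suc * show ?case by (simp add: add.commute)
  qed
  then show ?thesis by blast
qed

text \<open>Both sequences obey the same recurrence for k >= 1, so the weighted Casoratian is
  constant; at k = 0 it is the defect 1 of \<open>num\<close> times \<open>den n 0\<close>.\<close>

lemma casoratian_row:
  "(real k + 1)^3 * (num n (Suc k) * den n k - num n k * den n (Suc k)) = 1"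
proof (induction k)
  case 0
  show ?case using num_row[of 0 n] den_row[of 0 n] by (simp add: algebra_simps)
next
  case (Suc k)
  have "(real (Suc k) + 1)^3
      * (num n (Suc (Suc k)) * den n (Suc k) - num n (Suc k) * den n (Suc (Suc k)))
    = ((real (Suc k) + 1)^3 * num n (Suc (Suc k))) * den n (Suc k)
      - num n (Suc k) * ((real (Suc k) + 1)^3 * den n (Suc (Suc k)))"
    by (simp only: algebra_simps)
  also have "\<dots> = (real k + 1)^3 * (num n (Suc k) * den n k - num n k * den n (Suc k))"
    unfolding num_row den_row shifted_Suc by (simp only: algebra_simps)
  finally show ?case using Suc by simp
qed

text \<open>The \<open>step_coeff\<close> terms cancel, which leaves the Casoratian of row
  \<open>n\<close>.\<close>

lemma casoratian_column:
  "(real n + 1)^3 * (num (Suc n) k * den n k - num n k * den (Suc n) k) = 1"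
proof -
  have "(real n + 1)^3 * (num (Suc n) k * den n k - num n k * den (Suc n) k)
    = ((real n + 1)^3 * num (Suc n) k) * den n k - num n k * ((real n + 1)^3 * den (Suc n) k)"
    by (simp only: algebra_simps)
  also have "\<dots> = (real k + 1)^3 * (num n (Suc k) * den n k - num n k * den n (Suc k))"
    unfolding array_Suc by (simp only: algebra_simps)
  also have "\<dots> = 1" by (rule casoratian_row)
  finally show ?thesis .
qed

section \<open>Convergence of the ratios and size of the remainder\<close>

lemma ratio_row:
  "num n (Suc k) / den n (Suc k) - num n k / den n k = 1 / ((real k + 1)^3 * den n k * den n (Suc k))"
  using casoratian_row[of k n] den_pos[of n k] den_pos[of n "Suc k"]
  by (simp add: divide_simps del: array.simps) (simp add: mult_ac del: array.simps)

lemma ratio_column: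
  "num (Suc n) k / den (Suc n) k - num n k / den n k = 1 / ((real n + 1)^3 * den n k * den (Suc n) k)"
  using casoratian_column[of n k] den_pos[of n k] den_pos[of "Suc n" k]
  by (simp add: divide_simps del: array.simps) (simp add: mult_ac del: array.simps)

definition zeta3 :: real where
  "zeta3 = (\<Sum>n. 1 / (real n + 1)^3)"

lemma summable_inverse_cubes: "summable (\<lambda>n. 1 / (real n + 1)^3)"
  using inverse_power_summable[of 3, where ?'a = real, THEN summable_Suc_iff[THEN iffD2]]
  by (simp add: inverse_eq_divide add.commute)

lemma cubes_tendsto: "cubes \<longlonglongrightarrow> zeta3"
  unfolding zeta3_def cubes_def by (rule summable_LIMSEQ[OF summable_inverse_cubes])

lemma incseq_cubes: "incseq cubes"
  by (rule incseq_SucI) (simp add: cubes_def)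

lemma cubes_nonneg: "0 \<le> cubes k"
  unfolding cubes_def by (intro sum_nonneg) simp

text \<open>Adjacent rows have the same limit: by \<open>ratio_column\<close> and the linear growth
  of \<open>den\<close> their ratios differ by at most 1/(k+1).\<close>

lemma ratio_tendsto: "(\<lambda>k. num n k / den n k) \<longlonglongrightarrow> zeta3"
proof (induction n)
  case 0
  show ?case using cubes_tendsto by simp
next
  case (Suc n)
  have "(\<lambda>k. num (Suc n) k / den (Suc n) k - num n k / den n k) \<longlonglongrightarrow> 0"
  proof (rule real_tendsto_sandwich)
    show "\<forall>\<^sub>F k in sequentially. 0 \<le> num (Suc n) k / den (Suc n) k - num n k / den n k"
      unfolding ratio_column using den_pos by (intro always_eventually) (simp add: less_imp_le del: array.simps)
    have "1 / ((real n + 1)^3 * den n k * den (Suc n) k) \<le> 1 / (real k + 1)" for k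
    proof -
      have "1 * 1 * (real k + 1) \<le> (real n + 1)^3 * den n k * den (Suc n) k"
        using den_ge_1[of n k] den_ge_linear[of "Suc n" k] by (intro mult_mono) auto
      then show ?thesis by (simp add: frac_le del: array.simps)
    qed
    then show "\<forall>\<^sub>F k in sequentially. num (Suc n) k / den (Suc n) k - num n k / den n k \<le> 1 / (real k + 1)"
      unfolding ratio_column by (rule always_eventually[OF allI])
    show "(\<lambda>k. 1 / (real k + 1)) \<longlonglongrightarrow> 0"
      using LIMSEQ_inverse_real_of_nat by (simp add: inverse_eq_divide add.commute)
  qed simp
  from tendsto_add[OF this Suc] show ?case by (simp del: array.simps)
qed

lemma remainder_bounds:
  "0 \<le> zeta3 * den n k - num n k" "zeta3 * den n k - num n k \<le> zeta3"
proof -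
  let ?q = "\<lambda>k. num n k / den n k"
  have "incseq ?q"
  proof (rule incseq_SucI)
    fix k
    have "0 \<le> ?q (Suc k) - ?q k"
      unfolding ratio_row using den_pos by (simp add: less_imp_le)
    then show "?q k \<le> ?q (Suc k)" by simp
  qed
  then have "?q k \<le> zeta3" by (rule incseq_le[OF _ ratio_tendsto])
  then show "0 \<le> zeta3 * den n k - num n k" using den_pos[of n k] by (simp add: divide_simps)
  \<comment> \<open>Compared with \<open>cubes\<close>, each increment of the ratio gains a factor
    of at most 1 / \<open>den n k\<close>, by monotonicity of \<open>den\<close>; this later cancels
    the multiplication by \<open>den n k\<close>.\<close>
  have "?q m - ?q k \<le> (cubes m - cubes k) / den n k" if "k \<le> m" for m
    using that
  proof (induction m rule: dec_induct)
    case (step m)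
    have "den n k \<le> den n m"
      using lift_Suc_mono_le[of "den n", OF den_mono] step by blast
    then have "(real m + 1)^3 * den n k * 1 \<le> (real m + 1)^3 * den n m * den n (Suc m)"
      using den_ge_1[of n "Suc m"] den_pos[of n m] den_pos[of n k] by (intro mult_mono) (auto simp: less_imp_le)
    then have "?q (Suc m) - ?q m \<le> 1 / ((real m + 1)^3 * den n k)"
      unfolding ratio_row using den_pos[of n k] by (intro divide_left_mono) (auto simp: den_pos)
    also have "\<dots> = (cubes (Suc m) - cubes m) / den n k"
      by (simp add: cubes_def)
    finally show ?case using step.IH by (simp add: diff_divide_distrib)
  qed simp
  then have "zeta3 - ?q k \<le> (zeta3 - cubes k) / den n k"
    by (intro LIMSEQ_le[OF tendsto_diff[OF ratio_tendsto tendsto_const]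
          tendsto_divide[OF tendsto_diff[OF cubes_tendsto tendsto_const] tendsto_const]])
      (use den_pos[of n k] in auto)
  then have "zeta3 * den n k - num n k \<le> zeta3 - cubes k"
    using den_pos[of n k] by (simp add: pos_le_divide_eq left_diff_distrib)
  then show "zeta3 * den n k - num n k \<le> zeta3" using cubes_nonneg[of k] by linarith
qed

lemma zeta3_nonneg: "0 \<le> zeta3"
  using incseq_le[OF incseq_cubes cubes_tendsto, of 0] by (simp add: cubes_def)

text \<open>Termwise from \<open>remainder_bounds\<close>; the squared binomials sum to
  \<open>2 * n choose n\<close>, which is at most 4^n.\<close>

lemma remainder_sum_bounds:
  "0 \<le> zeta3 * binomial_sum den n - binomial_sum num n"
  "zeta3 * binomial_sum den n - binomial_sum num n \<le> zeta3 * 4 ^ n"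
proof -
  have eq: "zeta3 * binomial_sum den n - binomial_sum num n
      = (\<Sum>k\<le>n. real (n choose k)^2 * (zeta3 * den n k - num n k))"
    unfolding binomial_sum_def sum_distrib_left sum_subtractf[symmetric]
    by (intro sum.cong) (auto simp: algebra_simps)
  show "0 \<le> zeta3 * binomial_sum den n - binomial_sum num n"
    unfolding eq by (intro sum_nonneg mult_nonneg_nonneg remainder_bounds) simp
  have "(\<Sum>k\<le>n. real (n choose k)^2 * (zeta3 * den n k - num n k))
      \<le> (\<Sum>k\<le>n. real (n choose k)^2 * zeta3)"
    by (intro sum_mono mult_left_mono remainder_bounds) simp
  also have "\<dots> = real (\<Sum>k\<le>n. (n choose k)^2) * zeta3"
    by (simp add: sum_distrib_right)
  also have "\<dots> = zeta3 * real ((2 * n) choose n)"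
    by (simp only: choose_square_sum mult.commute)
  also have "\<dots> \<le> zeta3 * real (2 ^ (2 * n))"
    by (intro mult_left_mono of_nat_mono binomial_le_pow2 zeta3_nonneg)
  also have "\<dots> = zeta3 * 4 ^ n" by (simp add: power_mult)
  finally show "zeta3 * binomial_sum den n - binomial_sum num n \<le> zeta3 * 4 ^ n" unfolding eq .
qed

text \<open>The 7 of the limit arises here: \<open>num 1 0\<close> is 1 and \<open>num 1 1\<close>
  is 6, so the sums of \<open>num\<close> match 7 C.\<close>

lemma binomial_sum_initial:
  "binomial_sum den 0 = 1" "binomial_sum den 1 = 6" "binomial_sum num 0 = 0" "binomial_sum num 1 = 7"
  by (simp_all add: binomial_sum_def step_coeff_def cubes_def numeral_2_eq_2)

section \<open>Passage from rational to real sequences, and the limit\<close>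

lemma solves_recurrence_real:
  assumes "solves_recurrence u"
  shows "recurrence_real (\<lambda>n. real_of_rat (u n))"
  unfolding recurrence_real_def
proof (intro allI impI)
  fix n :: nat assume "1 \<le> n"
  with assms have "of_rat (4 * of_nat n ^ 2 * (16 * of_nat n ^ 2 - 1) * u (n - 1)
        - (65 * of_nat n ^ 4 + 130 * of_nat n ^ 3 + 105 * of_nat n ^ 2 + 40 * of_nat n + 6) * u n
        + (of_nat n + 1) ^ 4 * u (n + 1)) = real_of_rat 0"
    unfolding solves_recurrence_def by (metis (no_types))
  then show "4 * real n ^ 2 * (16 * real n ^ 2 - 1) * real_of_rat (u (n - 1))
        - (65 * real n ^ 4 + 130 * real n ^ 3 + 105 * real n ^ 2 + 40 * real n + 6) * real_of_rat (u n)
        + (real n + 1) ^ 4 * real_of_rat (u (n + 1)) = 0"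
    by (simp add: of_rat_add of_rat_mult of_rat_diff of_rat_power)
qed

lemma recurrence_real_cmult: "recurrence_real u \<Longrightarrow> recurrence_real (\<lambda>n. c * u n)"
  unfolding recurrence_real_def by (auto simp flip: distrib_left right_diff_distrib simp: mult.left_commute[of _ c])

lemma zeta_3_eq: "zeta 3 = complex_of_real zeta3"
proof -
  have "1 / of_nat (Suc n) powr 3 = complex_of_real (1 / (real n + 1)^3)" for n
    using powr_nat'[of "of_nat (Suc n)" 3] by (simp add: add.commute)
  then have "zeta 3 = (\<Sum>n. complex_of_real (1 / (real n + 1)^3))"
    unfolding zeta_def by presburger
  then show ?thesis
    unfolding zeta3_def by (simp only: suminf_of_real[OF summable_inverse_cubes])
qed

lemma of_rat_eq_of_real_of_rat: "of_rat q = complex_of_real (of_rat q)"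
  by (cases q) (simp add: of_rat_rat)

theorem corollary2p4:
  fixes A C :: "nat \<Rightarrow> rat"
  assumes "solves_recurrence A" and "A 0 = 1" and "A 1 = 6"
    and "solves_recurrence C" and "C 0 = 0" and "C 1 = 1"
  shows "(\<lambda>n. of_rat (C n / A n)) \<longlonglongrightarrow> zeta 3 / 7"
proof -
  define a where "a n = real_of_rat (A n)" for n
  define c where "c n = real_of_rat (C n)" for n
  have rec_a: "recurrence_real a" and rec_c: "recurrence_real (\<lambda>n. 7 * c n)"
    using solves_recurrence_real[OF assms(1)] solves_recurrence_real[OF assms(4)]
    unfolding a_def c_def by (auto intro: recurrence_real_cmult)
  have a01: "a 0 = 1" "a 1 = 6" using assms by (simp_all add: a_def)
  have a: "a n = binomial_sum den n" for n
    using recurrence_real_unique[OF rec_a recurrence_real_binomial_sum[OF row_recurrence_den]]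
      a01 binomial_sum_initial by simp
  have c: "7 * c n = binomial_sum num n" for n
    using recurrence_real_unique[OF rec_c recurrence_real_binomial_sum[OF row_recurrence_num]]
      assms(5,6) binomial_sum_initial by (simp add: c_def)
  have lower: "6 ^ n \<le> a n" for n by (rule recurrence_real_lower[OF rec_a a01])
  then have pos: "0 < a n" for n by (rule less_le_trans[rotated]) simp
  \<comment> \<open>The rate 2/3 is 4/6: remainder growth over the growth of
    \<open>a\<close>.\<close>
  have bounds: "0 \<le> zeta3 - 7 * (c n / a n)" "zeta3 - 7 * (c n / a n) \<le> zeta3 * (2/3)^n" for n
  proof -
    have eq: "zeta3 - 7 * (c n / a n) = (zeta3 * a n - 7 * c n) / a n"
      using pos[of n] by (simp add: field_simps)
    show "0 \<le> zeta3 - 7 * (c n / a n)"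
      unfolding eq using remainder_sum_bounds(1)[of n] pos[of n] by (simp add: a c)
    have "(zeta3 * a n - 7 * c n) / a n \<le> (zeta3 * 4^n) / 6^n"
      using remainder_sum_bounds(2)[of n] lower zeta3_nonneg by (intro frac_le) (simp_all add: a c)
    also have "\<dots> = zeta3 * (4/6)^n" by (simp only: power_divide times_divide_eq_right)
    finally show "zeta3 - 7 * (c n / a n) \<le> zeta3 * (2/3)^n" unfolding eq by simp
  qed
  have "(\<lambda>n. zeta3 * (2/3)^n) \<longlonglongrightarrow> zeta3 * 0"
    by (intro tendsto_mult tendsto_const LIMSEQ_power_zero) simp
  then have "(\<lambda>n. zeta3 - 7 * (c n / a n)) \<longlonglongrightarrow> 0"
    using real_tendsto_sandwich[of "\<lambda>_. 0" "\<lambda>n. zeta3 - 7 * (c n / a n)" sequentially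
        "\<lambda>n. zeta3 * (2/3)^n" 0] bounds by simp
  then have "(\<lambda>n. (zeta3 - (zeta3 - 7 * (c n / a n))) / 7) \<longlonglongrightarrow> (zeta3 - 0) / 7"
    by (intro tendsto_divide tendsto_diff tendsto_const) simp_all
  then have "(\<lambda>n. c n / a n) \<longlonglongrightarrow> zeta3 / 7" by simp
  then have "(\<lambda>n. complex_of_real (c n / a n)) \<longlonglongrightarrow> complex_of_real (zeta3 / 7)"
    by (rule tendsto_of_real)
  moreover have "of_rat (C n / A n) = complex_of_real (c n / a n)" for n
    by (simp add: a_def c_def of_rat_divide of_rat_eq_of_real_of_rat)
  ultimately show ?thesis by (simp add: zeta_3_eq)
qed

end
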